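(* There exists an infinite family of Steiner triple systems $\mathrm{STS}(n)$ (that is, such systems exist for infinitely many orders $n$) each of which has a minimal spreading set $U$ of size $|U|=\log_2(n+1)-1$.
   Context: A Steiner triple system $\mathrm{STS}(n)$ of order $n$ is a set $V$ of $n$ points together with a family $\mathcal{F}$ of $3$-element subsets (triples) of $V$ such that every pair of distinct points of $V$ is contained in exactly one triple. For $V'\subseteq V$, the set of neighbours $N(V')$ consists of all $z\in V\setminus V'$ for which there exist distinct $x,y\in V'$ with $\{x,y,z\}\in\mathcal{F}$. The closure $\mathrm{cl}(V')$ is the smallest set $W\supseteq V'$ with $N(W)=\emptyset$ (it exists and is unique). A set $V'\subseteq V$ is spreading if $\mathrm{cl}(V')=V$. A spreading set is minimal if none of its proper subsets is a spreading set. *)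

theory Defs
  imports Complex_Main
begin

definition steiner_triple_system :: "nat \<Rightarrow> 'a set \<Rightarrow> 'a set set \<Rightarrow> bool" where
  "steiner_triple_system n V F \<longleftrightarrow>
     finite V \<and> card V = n \<and>
     (\<forall>T\<in>F. T \<subseteq> V \<and> card T = 3) \<and>
     (\<forall>x\<in>V. \<forall>y\<in>V. x \<noteq> y \<longrightarrow> (\<exists>!T. T \<in> F \<and> x \<in> T \<and> y \<in> T))"

definition neighbours :: "'a set \<Rightarrow> 'a set set \<Rightarrow> 'a set \<Rightarrow> 'a set" where
  "neighbours V F V' = {z \<in> V - V'. \<exists>x\<in>V'. \<exists>y\<in>V'. x \<noteq> y \<and> {x, y, z} \<in> F}"

text \<open>The least element is taken with respect to inclusion; it exists for every \<open>V' \<subseteq> V\<close>,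
  see \<open>sts_closure_eq_Inter\<close> below.\<close>

definition sts_closure :: "'a set \<Rightarrow> 'a set set \<Rightarrow> 'a set \<Rightarrow> 'a set" where
  "sts_closure V F V' = (LEAST W. V' \<subseteq> W \<and> W \<subseteq> V \<and> neighbours V F W = {})"

definition spreading :: "'a set \<Rightarrow> 'a set set \<Rightarrow> 'a set \<Rightarrow> bool" where
  "spreading V F V' \<longleftrightarrow> V' \<subseteq> V \<and> sts_closure V F V' = V"

definition minimal_spreading :: "'a set \<Rightarrow> 'a set set \<Rightarrow> 'a set \<Rightarrow> bool" where
  "minimal_spreading V F U \<longleftrightarrow> spreading V F U \<and> (\<forall>U'. U' \<subset> U \<longrightarrow> \<not> spreading V F U')"

lemma sts_closure_eq_Inter:
  assumes "V' \<subseteq> V"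
  shows "sts_closure V F V' = \<Inter>{W. V' \<subseteq> W \<and> W \<subseteq> V \<and> neighbours V F W = {}}"
    (is "_ = \<Inter>?C")
  unfolding sts_closure_def
proof (rule Least_equality)
  have V: "V' \<subseteq> V \<and> V \<subseteq> V \<and> neighbours V F V = {}"
    using assms by (simp add: neighbours_def)
  have "z \<notin> neighbours V F (\<Inter>?C)" for z
  proof
    assume z: "z \<in> neighbours V F (\<Inter>?C)"
    then obtain x y where xy: "x \<in> \<Inter>?C" "y \<in> \<Inter>?C" "x \<noteq> y" "{x, y, z} \<in> F"
      and zV: "z \<in> V" and "z \<notin> \<Inter>?C"
      by (auto simp: neighbours_def)
    then obtain W where W: "W \<in> ?C" "z \<notin> W"
      by (meson InterI)
    have "x \<in> W" "y \<in> W"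
      using xy(1,2) W(1) by (meson InterD)+
    then have "z \<in> neighbours V F W"
      unfolding neighbours_def using xy(3,4) zV W(2) by (intro CollectI conjI DiffI bexI[of _ x] bexI[of _ y])
    with W(1) show False by simp
  qed
  then have "neighbours V F (\<Inter>?C) = {}"
    by (intro equals0I) (rule notE)
  moreover have "\<Inter>?C \<subseteq> V"
    by (rule Inter_lower) (rule CollectI, rule V)
  moreover have "V' \<subseteq> \<Inter>?C"
    by (rule Inter_greatest) simp
  ultimately show "V' \<subseteq> \<Inter>?C \<and> \<Inter>?C \<subseteq> V \<and> neighbours V F (\<Inter>?C) = {}"
    by (intro conjI)
next
  fix W assume "V' \<subseteq> W \<and> W \<subseteq> V \<and> neighbours V F W = {}"
  then show "\<Inter>?C \<le> W"
    by (intro Inter_lower CollectI)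
qed

end

theory Submission imports Defs begin

text \<open>
  A Steiner triple system is the same thing as a Steiner loop (adjoin a unit \<open>e\<close> and let \<open>x \<cdot> y\<close> be
  the third point of the triple through \<open>x \<noteq> y\<close>), and its closed sets are the subloops without \<open>e\<close>.
  The projective space over \<open>\<int>/2\<close> of order \<open>2^k - 1\<close> is the loop of bitwise xor on \<open>{..<2^k}\<close>.
  Relabel its plane \<open>{1,\<dots>,7}\<close> by the transposition of \<open>1\<close> and \<open>4\<close>. Lines not in the plane are
  unaffected, but the line through \<open>1\<close> and \<open>2\<close> is now \<open>{1,2,6}\<close> instead of \<open>{1,2,3}\<close>. The points \<open>1, 2, 8, 16, \<dots>, 2^(k-1)\<close>
  spanned only a hyperplane before. Now \<open>1\<close>, \<open>2\<close> and \<open>8\<close> already generate \<open>3\<close> (through lines outside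
  the plane) and \<open>6\<close> (inside it), and thereby the whole plane, so these \<open>k - 1\<close> points generate
  everything. Each of them is indispensable: the others lie in a linear subspace which meets the plane
  in a single point, if \<open>1\<close> or \<open>2\<close> is left out, or contains the plane, and which therefore stays closed.
\<close>

unbundle bit_operations_syntax

section \<open>Steiner loops\<close>

text \<open>The equational laws are assumed on the whole type, so that rewriting with them needs no
  membership in \<open>L\<close>.\<close>

locale steiner_loop =
  fixes L :: "'a set" and mult :: "'a \<Rightarrow> 'a \<Rightarrow> 'a" (infixl \<open>\<cdot>\<close> 70) and e :: 'a
  assumes finite_L: "finite L"
    and unit_closed: "e \<in> L"
    and mult_closed: "x \<in> L \<Longrightarrow> y \<in> L \<Longrightarrow> x \<cdot> y \<in> L"
    and mult_commute: "x \<cdot> y = y \<cdot> x"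
    and mult_unit: "x \<cdot> e = x"
    and mult_self: "x \<cdot> x = e"
    and mult_cancel: "x \<cdot> (x \<cdot> y) = y"
begin

definition points :: "'a set" where
  "points = L - {e}"

definition triples :: "'a set set" where
  "triples = {{x, y, x \<cdot> y} | x y. x \<in> points \<and> y \<in> points \<and> x \<noteq> y}"

lemma mult_neq_left: "y \<noteq> e \<Longrightarrow> x \<cdot> y \<noteq> x"
  by (metis mult_cancel mult_self)

lemma mult_neq_right: "x \<noteq> e \<Longrightarrow> x \<cdot> y \<noteq> y"
  by (metis mult_commute mult_neq_left)

lemma mult_neq_unit: "x \<noteq> y \<Longrightarrow> x \<cdot> y \<noteq> e"
  by (metis mult_cancel mult_unit)

lemma mult_points: "x \<in> points \<Longrightarrow> y \<in> points \<Longrightarrow> x \<noteq> y \<Longrightarrow> x \<cdot> y \<in> points"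
  by (simp add: points_def mult_closed mult_neq_unit)

text \<open>Each of \<open>a\<close>, \<open>b\<close>, \<open>a \<cdot> b\<close> is the product of
  the other two, so any two points of a triple determine the third.\<close>

lemma triple_eq:
  assumes "T \<in> triples" "x \<in> T" "y \<in> T" "x \<noteq> y"
  shows "T = {x, y, x \<cdot> y}"
proof -
  obtain a b where T: "T = {a, b, a \<cdot> b}"
    using assms(1) by (auto simp: triples_def)
  have "a \<cdot> (a \<cdot> b) = b" "b \<cdot> a = a \<cdot> b" "(a \<cdot> b) \<cdot> a = b" "b \<cdot> (a \<cdot> b) = a" "(a \<cdot> b) \<cdot> b = a"
    by (metis mult_cancel mult_commute)+
  with assms(2-4) show ?thesis
    unfolding T by auto
qed

lemma triple_mem_iff:
  assumes "x \<in> points" "y \<in> points" "x \<noteq> y" "z \<noteq> x" "z \<noteq> y"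
  shows "{x, y, z} \<in> triples \<longleftrightarrow> z = x \<cdot> y"
proof
  assume "{x, y, z} \<in> triples"
  then have "{x, y, z} = {x, y, x \<cdot> y}"
    using triple_eq assms(3) by blast
  with assms(4,5) show "z = x \<cdot> y" by blast
next
  assume "z = x \<cdot> y"
  with assms(1-3) show "{x, y, z} \<in> triples"
    by (auto simp: triples_def)
qed

lemma steiner_triple_system_loop:
  "steiner_triple_system (card L - 1) points triples"
  unfolding steiner_triple_system_def
proof (intro conjI ballI impI)
  show "finite points" "card points = card L - 1"
    by (simp_all add: points_def finite_L unit_closed)
next
  fix T assume "T \<in> triples"
  then obtain x y where T: "T = {x, y, x \<cdot> y}" and xy: "x \<in> points" "y \<in> points" "x \<noteq> y"
    by (auto simp: triples_def)
  then show "T \<subseteq> points"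
    by (simp add: mult_points)
  have "x \<cdot> y \<noteq> x" "x \<cdot> y \<noteq> y"
    using xy by (simp_all add: points_def mult_neq_left mult_neq_right)
  with T xy show "card T = 3"
    by (auto simp: card_insert_if)
next
  fix x y assume "x \<in> points" "y \<in> points" "x \<noteq> y"
  then have "{x, y, x \<cdot> y} \<in> triples"
    by (auto simp: triples_def)
  then show "\<exists>!T. T \<in> triples \<and> x \<in> T \<and> y \<in> T"
    using triple_eq[OF _ _ _ \<open>x \<noteq> y\<close>] by blast
qed

lemma neighbours_empty_iff:
  assumes "W \<subseteq> points"
  shows "neighbours points triples W = {} \<longleftrightarrow> (\<forall>x\<in>W. \<forall>y\<in>W. x \<noteq> y \<longrightarrow> x \<cdot> y \<in> W)"
proof -
  have "z \<in> neighbours points triples W \<longleftrightarrow>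
      z \<notin> W \<and> (\<exists>x\<in>W. \<exists>y\<in>W. x \<noteq> y \<and> z = x \<cdot> y)" for z
  proof -
    have "{x, y, z} \<in> triples \<longleftrightarrow> z = x \<cdot> y"
      if "x \<in> W" "y \<in> W" "x \<noteq> y" "z \<notin> W" for x y
      using that assms by (intro triple_mem_iff) auto
    then show ?thesis
      using mult_points assms unfolding neighbours_def by blast
  qed
  then have "neighbours points triples W = {z. z \<notin> W \<and> (\<exists>x\<in>W. \<exists>y\<in>W. x \<noteq> y \<and> z = x \<cdot> y)}"
    by (intro set_eqI) simp
  then show ?thesis by auto
qed

text \<open>The closure is the intersection of all closed supersets; it is everything exactly when
  \<open>points\<close> is the only one of them.\<close>

lemma spreading_iff:
  "spreading points triples U \<longleftrightarrow> U \<subseteq> points \<and>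
     (\<forall>W. U \<subseteq> W \<longrightarrow> W \<subseteq> points \<longrightarrow> (\<forall>x\<in>W. \<forall>y\<in>W. x \<noteq> y \<longrightarrow> x \<cdot> y \<in> W) \<longrightarrow> W = points)"
proof (cases "U \<subseteq> points")
  case True
  define C where "C = {W. U \<subseteq> W \<and> W \<subseteq> points \<and> neighbours points triples W = {}}"
  have top: "points \<in> C"
    using True by (simp add: C_def neighbours_def)
  have sub: "W \<subseteq> points" if "W \<in> C" for W
    using that by (simp add: C_def)
  have Inter: "\<Inter>C = points \<longleftrightarrow> (\<forall>W\<in>C. W = points)"
  proof (intro iffI ballI)
    fix W assume "\<Inter>C = points" "W \<in> C"
    then show "W = points"
      using Inter_lower[of W C] sub by blast
  next
    assume "\<forall>W\<in>C. W = points"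
    then show "\<Inter>C = points"
      by (intro antisym Inter_lower Inter_greatest top) (metis order_refl)
  qed
  have spr: "spreading points triples U \<longleftrightarrow> \<Inter>C = points"
    using True by (simp add: spreading_def sts_closure_eq_Inter C_def)
  have "W \<in> C \<longleftrightarrow> U \<subseteq> W \<and> W \<subseteq> points \<and> (\<forall>x\<in>W. \<forall>y\<in>W. x \<noteq> y \<longrightarrow> x \<cdot> y \<in> W)" for W
    unfolding C_def using neighbours_empty_iff by auto
  then show ?thesis
    unfolding spr Inter using True by meson
qed (simp add: spreading_def)

text \<open>A proper subset of \<open>U\<close> misses some \<open>u\<close>, so a proper closed set
  around \<open>U - {u}\<close> traps its closure.\<close>

lemma minimal_spreadingI:
  assumes "spreading points triples U"
    and "\<And>u. u \<in> U \<Longrightarrow> \<exists>W. U - {u} \<subseteq> W \<and> W \<subset> points \<and> (\<forall>x\<in>W. \<forall>y\<in>W. x \<noteq> y \<longrightarrow> x \<cdot> y \<in> W)"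
  shows "minimal_spreading points triples U"
  unfolding minimal_spreading_def
proof (intro conjI allI impI notI)
  fix U' assume "U' \<subset> U" and spr: "spreading points triples U'"
  then obtain u where "u \<in> U" "U' \<subseteq> U - {u}" by blast
  then obtain W where "U' \<subseteq> W" "W \<subset> points" "\<forall>x\<in>W. \<forall>y\<in>W. x \<noteq> y \<longrightarrow> x \<cdot> y \<in> W"
    using assms(2) by (meson subset_trans)
  with spr show False
    unfolding spreading_iff by blast
qed (rule assms(1))

end

section \<open>The projective space with a relabelled plane\<close>

lemma xor_less_exp_nat:
  fixes x y :: nat
  assumes "x < 2 ^ n" "y < 2 ^ n"
  shows "x XOR y < 2 ^ n"
  using assms by (metis take_bit_nat_eq_self_iff take_bit_xor)

lemma xor_cancel_nat: "x XOR (x XOR y) = (y :: nat)"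
  by (simp flip: xor.assoc)

lemma xor_exp_eq_add:
  fixes r :: nat
  assumes "r < 2 ^ n"
  shows "r XOR 2 ^ n = r + 2 ^ n"
proof -
  have "\<not> bit r n"
    using assms by (metis bit_take_bit_iff less_irrefl take_bit_nat_eq_self_iff)
  then have "flip_bit n r = set_bit n r"
    by (simp add: flip_bit_eq_if)
  with \<open>\<not> bit r n\<close> show ?thesis
    by (simp add: flip_bit_eq_xor set_bit_eq push_bit_eq_mult)
qed

text \<open>This exchanges two labels, not the bits 0 and 2: a bit exchange would be linear and
  leave \<open>XOR\<close> unchanged.\<close>

definition swap14 :: "nat \<Rightarrow> nat" where
  "swap14 = id(1 := 4, 4 := 1)"

definition twisted_xor :: "nat \<Rightarrow> nat \<Rightarrow> nat" where
  "twisted_xor x y =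
     (if x < 8 \<and> y < 8 then swap14 (swap14 x XOR swap14 y) else x XOR y)"

lemma swap14_swap14: "swap14 (swap14 x) = x"
  by (simp add: swap14_def)

lemma swap14_less_8: "x < 8 \<Longrightarrow> swap14 x < 8"
  by (simp add: swap14_def)

lemma xor_less_8: "(x :: nat) < 8 \<Longrightarrow> y < 8 \<Longrightarrow> x XOR y < 8"
  using xor_less_exp_nat[of x 3 y] by simp

lemma twisted_xor_less_8: "x < 8 \<Longrightarrow> y < 8 \<Longrightarrow> twisted_xor x y < 8"
  by (simp add: twisted_xor_def swap14_less_8 xor_less_8)

text \<open>\<open>{..<8}\<close> is closed under both operations, so \<open>(x, y)\<close> and
  \<open>(x, twisted_xor x y)\<close> fall into the same branch, and each branch is a conjugate of
  \<open>XOR\<close> or \<open>XOR\<close> itself.\<close>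

lemma twisted_xor_cancel: "twisted_xor x (twisted_xor x y) = y"
proof (cases "x < 8 \<and> y < 8")
  case True
  then have "twisted_xor x y < 8"
    by (simp add: twisted_xor_less_8)
  with True show ?thesis
    by (simp add: twisted_xor_def swap14_swap14 xor_cancel_nat)
next
  case False
  then have "\<not> (x < 8 \<and> x XOR y < 8)"
    by (metis xor_cancel_nat xor_less_8)
  with False show ?thesis
    by (auto simp: twisted_xor_def xor_cancel_nat)
qed

lemma steiner_loop_twisted_xor:
  assumes "3 \<le> k"
  shows "steiner_loop {..<2 ^ k} twisted_xor 0"
proof
  fix x y :: nat assume xy: "x \<in> {..<2 ^ k}" "y \<in> {..<2 ^ k}"
  have "(8 :: nat) \<le> 2 ^ k"
    using power_increasing[OF assms, of "2 :: nat"] by simp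
  with xy show "twisted_xor x y \<in> {..<2 ^ k}"
    using twisted_xor_less_8[of x y] xor_less_exp_nat[of x k y]
    by (cases "x < 8 \<and> y < 8") (auto simp: twisted_xor_def)
qed (simp_all add: twisted_xor_cancel, simp_all add: twisted_xor_def swap14_def xor.commute)

lemma not_bit_less_8:
  fixes x :: nat
  assumes "x < 8" "3 \<le> j"
  shows "\<not> bit x j"
proof -
  have "x = take_bit 3 x"
    using assms(1) by (simp add: take_bit_nat_eq_self)
  with assms(2) show ?thesis
    by (metis bit_take_bit_iff not_le)
qed

section \<open>Generation and irredundance of the basis without 4\<close>

definition generators :: "nat \<Rightarrow> nat set" where
  "generators k = (\<lambda>j. 2 ^ j) ` ({..<k} - {2})"

lemma card_generators: "3 \<le> k \<Longrightarrow> card (generators k) = k - 1"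
  by (simp add: generators_def card_image inj_on_def)

text \<open>Induction on the dimension. It starts at 4 because the detour out of the plane needs 8;
  1 and 2 alone generate only \<open>{1, 2, 6}\<close>.\<close>

lemma twisted_xor_generates:
  assumes k: "4 \<le> k" and gen: "generators k \<subseteq> W"
    and closed: "\<And>x y. x \<in> W \<Longrightarrow> y \<in> W \<Longrightarrow> x \<noteq> y \<Longrightarrow> twisted_xor x y \<in> W"
  shows "{1..<2 ^ k} \<subseteq> W"
proof -
  have "{1..<2 ^ j} \<subseteq> W" if "4 \<le> j" "j \<le> k" for j
    using that
  proof (induction j rule: dec_induct)
    case base
    have exp: "2 ^ j \<in> W" if "j < k" "j \<noteq> 2" for j
      using gen that by (auto simp: generators_def)
    have 1: "1 \<in> W" and 2: "2 \<in> W" and 8: "8 \<in> W"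
      using exp[of 0] exp[of 1] exp[of 3] k by simp_all
    note [simp] = twisted_xor_def swap14_def
    have 6: "6 \<in> W" using closed[OF 1 2] by simp
    \<comment> \<open>These three products leave the plane and return, so they follow plain
      \<open>XOR\<close> and give 3, the old product of 1 and 2.\<close>
    have 10: "10 \<in> W" using closed[OF 2 8] by simp
    have 11: "11 \<in> W" using closed[OF 1 10] by simp
    have 3: "3 \<in> W" using closed[OF 11 8] by (simp add: numeral_3_eq_3)
    \<comment> \<open>Since 3 is off the twisted line \<open>{1, 2, 6}\<close>, line and point
      generate the plane.\<close>
    have 5: "5 \<in> W" using closed[OF 3 6] by simp
    have 4: "4 \<in> W" using closed[OF 1 5] by simp
    have 7: "7 \<in> W" using closed[OF 2 5] by simp
    have "9 \<in> W" "12 \<in> W" "13 \<in> W" "14 \<in> W" "15 \<in> W"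
      using closed[OF 1 8] closed[OF 4 8] closed[OF 5 8] closed[OF 6 8] closed[OF 7 8]
      by simp_all
    moreover have "{1..<2 ^ 4} = {1, 2, 3, 4, 5, 6, 7, 8, 9, 10, 11, 12, 13, 14, 15 :: nat}"
      by (auto simp: atLeastLessThan_nat_numeral)
    ultimately show ?case
      using 1 2 3 4 5 6 7 8 10 11 by simp
  next
    case (step j)
    have exp: "2 ^ j \<in> W"
      using gen step.hyps step.prems by (auto simp: generators_def)
    \<comment> \<open>As \<open>2 ^ j\<close> lies outside the plane, its product with
      \<open>r < 2 ^ j\<close> is plain \<open>XOR\<close>, which is addition without carry.\<close>
    have "(2 :: nat) ^ 3 \<le> 2 ^ j"
      using step.hyps by (intro power_increasing) auto
    then have ge: "(8 :: nat) \<le> 2 ^ j" by simp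
    show ?case
    proof
      fix v :: nat assume v: "v \<in> {1..<2 ^ Suc j}"
      consider "v < 2 ^ j" | "v = 2 ^ j" | "2 ^ j < v" by linarith
      then show "v \<in> W"
      proof cases
        case 1
        with v step show ?thesis by auto
      next
        case 2
        with exp show ?thesis by simp
      next
        case 3
        define r where "r = v - 2 ^ j"
        have r: "r < 2 ^ j" "0 < r" "v = r + 2 ^ j"
          using 3 v by (auto simp: r_def)
        then have "r \<in> W"
          using step by auto
        then have "twisted_xor r (2 ^ j) \<in> W"
          using exp r by (intro closed) auto
        with r ge show ?thesis
          by (simp add: twisted_xor_def xor_exp_eq_add)
      qed
    qed
  qed
  then show ?thesis
    using k by blast
qed

text \<open>If \<open>j < 3\<close>, bit \<open>2\<close> has to vanish as well, so that the subspace meets the plane in one point only.\<close>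

lemma generators_irredundant:
  assumes "4 \<le> k" "u \<in> generators k"
  shows "\<exists>W. generators k - {u} \<subseteq> W \<and> W \<subset> {1..<2 ^ k} \<and>
    (\<forall>x\<in>W. \<forall>y\<in>W. x \<noteq> y \<longrightarrow> twisted_xor x y \<in> W)"
proof -
  interpret steiner_loop "{..<2 ^ k}" twisted_xor 0
    using assms(1) by (intro steiner_loop_twisted_xor) simp
  have points: "points = {1..<2 ^ k}"
    by (auto simp: points_def)
  obtain j where j: "j < k" "j \<noteq> 2" "u = 2 ^ j"
    using assms(2) by (auto simp: generators_def)
  define W :: "nat set"
    where "W = {v \<in> {1..<2 ^ k}. \<not> bit v j \<and> (j < 3 \<longrightarrow> \<not> bit v 2)}"
  have "generators k - {u} \<subseteq> W"
    using j by (auto simp: W_def generators_def bit_exp_iff)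
  moreover have "u \<in> {1..<2 ^ k}" "u \<notin> W"
    using j by (auto simp: W_def bit_exp_iff)
  then have "W \<subset> {1..<2 ^ k}"
    unfolding W_def by blast
  moreover have "twisted_xor x y \<in> W" if xy: "x \<in> W" "y \<in> W" "x \<noteq> y" for x y
  proof -
    have "twisted_xor x y \<in> {1..<2 ^ k}"
      using mult_points[of x y] xy unfolding points by (simp add: W_def)
    moreover have "\<not> bit (twisted_xor x y) j \<and> (j < 3 \<longrightarrow> \<not> bit (twisted_xor x y) 2)"
    proof (cases "x < 8 \<and> y < 8")
      case False
      with xy show ?thesis
        by (auto simp: twisted_xor_def W_def bit_xor_iff)
    next
      case True
      \<comment> \<open>Two distinct points of \<open>W\<close> in the plane exclude smaller
        \<open>j\<close>: for \<open>j = 0\<close> only 2 is left there, for \<open>j = 1\<close>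
        only 1.\<close>
      have "3 \<le> j"
      proof (rule ccontr)
        assume "\<not> 3 \<le> j"
        then have "j = 0 \<or> j = 1"
          using j(2) by linarith
        moreover have "v = 2 - j" if "v \<in> W" "v < 8" for v
        proof -
          from \<open>v < 8\<close> have "v \<in> {0, 1, 2, 3, 4, 5, 6, 7}" by auto
          with \<open>v \<in> W\<close> \<open>j = 0 \<or> j = 1\<close> show ?thesis
            by (auto simp: W_def bit_iff_odd)
        qed
        ultimately show False
          using True xy by metis
      qed
      \<comment> \<open>However the plane is twisted, the product stays below 8, so its bit
        \<open>j\<close> vanishes.\<close>
      with True show ?thesis
        by (simp add: not_bit_less_8 twisted_xor_less_8)
    qed
    ultimately show ?thesis
      by (simp add: W_def)
  qed
  ultimately show ?thesis by blast
qed

lemma exists_minimal_spreading: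
  assumes "4 \<le> k"
  shows "\<exists>(V :: nat set) F U. steiner_triple_system (2 ^ k - 1) V F \<and>
    minimal_spreading V F U \<and> card U = k - 1"
proof -
  interpret steiner_loop "{..<2 ^ k}" twisted_xor 0
    using assms by (intro steiner_loop_twisted_xor) simp
  have points: "points = {1..<2 ^ k}"
    by (auto simp: points_def)
  have "spreading points triples (generators k)"
    unfolding spreading_iff
  proof (intro conjI allI impI)
    show "generators k \<subseteq> points"
      by (auto simp: points generators_def)
    fix W assume "generators k \<subseteq> W" "W \<subseteq> points"
      "\<forall>x\<in>W. \<forall>y\<in>W. x \<noteq> y \<longrightarrow> twisted_xor x y \<in> W"
    then show "W = points"
      using twisted_xor_generates[OF assms, of W] unfolding points by blast
  qed
  then have "minimal_spreading points triples (generators k)"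
    using generators_irredundant[OF assms] by (intro minimal_spreadingI) (simp_all add: points)
  moreover have "steiner_triple_system (2 ^ k - 1) points triples"
    using steiner_triple_system_loop by simp
  ultimately show ?thesis
    using card_generators[of k] assms by (intro exI conjI) simp_all
qed

theorem proposition1p5:
  "infinite {n :: nat. \<exists>(V :: nat set) F U.
      steiner_triple_system n V F \<and> minimal_spreading V F U \<and>
      real (card U) = log 2 (real n + 1) - 1}"
proof (rule infinite_super)
  show "infinite ((\<lambda>k. 2 ^ k - 1 :: nat) ` {4..})"
  proof (subst finite_image_iff)
    show "inj_on (\<lambda>k. 2 ^ k - 1 :: nat) {4..}"
      by (intro inj_onI) (simp add: eq_diff_iff)
  qed (simp add: infinite_Ici)
  show "(\<lambda>k. 2 ^ k - 1 :: nat) ` {4..} \<subseteq> {n :: nat. \<exists>(V :: nat set) F U.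
      steiner_triple_system n V F \<and> minimal_spreading V F U \<and>
      real (card U) = log 2 (real n + 1) - 1}"
  proof (rule image_subsetI, rule CollectI)
    fix k :: nat assume "k \<in> {4..}"
    then have k: "4 \<le> k" by simp
    \<comment> \<open>Neither subtraction on \<open>nat\<close> is truncated, so the argument of the
      logarithm is \<open>2 ^ k\<close>.\<close>
    have log: "log 2 (real (2 ^ k - 1) + 1) - 1 = real (k - 1)"
      using k by (simp add: log_nat_power)
    show "\<exists>(V :: nat set) F U. steiner_triple_system (2 ^ k - 1) V F \<and>
        minimal_spreading V F U \<and> real (card U) = log 2 (real (2 ^ k - 1) + 1) - 1"
      unfolding log of_nat_eq_iff by (rule exists_minimal_spreading[OF k])
  qed
qed

end
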